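(* Let $p$ be an odd prime. (i) For all $d\in\{0,1,\ldots,p-1\}$ with $d\equiv (p+1)/2 \pmod 2$ we have $$\sum_{k=0}^{p-1}\frac{\binom{2k}{k}^2\binom{2k}{k+d}}{64^k}\equiv 0\pmod{p^2}.$$ (ii) If $p\equiv 3\pmod 4$, then $$\sum_{k=0}^{p-1}\frac{\binom{2k}{k}^2\binom{2k}{k+1}}{64^k}\equiv (2p+2-2^{p-1})\binom{(p-1)/2}{(p+1)/4}^2\pmod{p^2}.$$
   Context: Congruences modulo powers of $p$ between rational numbers whose denominators are prime to $p$ are understood in the ring of $p$-adic integers (equivalently, in the localization $\mathbb{Z}_{(p)}$). As usual, $\binom{n}{m}=0$ for integers $m>n\ge 0$. *)

theory Defs
  imports Complex_Main "HOL-Number_Theory.Cong"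
begin

text \<open>The localization of the integers at the prime \<open>p\<close>, as a subring of the rationals:
  \<open>quotient_of\<close> gives the representation in lowest terms with positive denominator.\<close>

definition Z_localized :: "nat \<Rightarrow> rat set" where
  "Z_localized p = {x. coprime (snd (quotient_of x)) (int p)}"

definition rat_cong :: "nat \<Rightarrow> nat \<Rightarrow> rat \<Rightarrow> rat \<Rightarrow> bool" where
  "rat_cong p n x y \<longleftrightarrow>
     x \<in> Z_localized p \<and> y \<in> Z_localized p \<and>
     (\<exists>z \<in> Z_localized p. x - y = of_nat (p ^ n) * z)"

end

theory Submission
  imports Defs "HOL-Number_Theory.Residues" "HOL-Computational_Algebra.Polynomial"
begin

text \<open>
  Write \<open>p = 2 * n + 1\<close>. The link to Legendre polynomials is the congruence
  \<open>binom(2k,k)^2 / 16^k \<equiv> (-1)^k binom(n,k) binom(n+k,k) (mod p^2)\<close> for \<open>k \<le> n\<close>: as \<open>k\<close>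
  grows by one, the left side is multiplied by \<open>(2k+1)^2 / (2k+2)^2\<close> and the right side by
  \<open>((2k+1)^2 - p^2) / (2k+2)^2\<close>. For \<open>n < k < p\<close> the left side is divisible by \<open>p^2\<close> and the right
  side is zero. The numbers on the right are the coefficients of \<open>P_n(1 - 2x)\<close>, where \<open>P_n\<close> is the
  Legendre polynomial.

  On the other hand, \<open>binom(2k,k+d) / 4^k\<close> is the coefficient of \<open>z^d\<close> in \<open>x^k\<close> for
  \<open>x = (1 + z)^2 / (4 z)\<close>, and then \<open>1 - 2x = -(z + 1/z)/2\<close>. So modulo \<open>p^2\<close> the sum with parameter
  \<open>d\<close> is the coefficient of \<open>z^d\<close> in \<open>P_n(-(z + 1/z)/2)\<close> (\<open>rat_cong_coeff_legendre_fourier\<close>), that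
  is, up to sign a Fourier coefficient of \<open>P_n(cos \<theta>)\<close>. The classical expansion
  \<open>P_n(cos \<theta>) = 4^(-n) \<Sum>_j binom(2j,j) binom(2(n-j),n-j) exp(i (n-2j) \<theta>)\<close>
  (\<open>coeff_legendre_fourier_closed\<close>, obtained from the three-term recurrence) shows that
  this coefficient vanishes unless \<open>d\<close> and \<open>n\<close> have the same parity, which is (i).

  For (ii), \<open>n = 2m + 1\<close> and \<open>d = 1\<close>, and the coefficient is
  \<open>-4^(-n) binom(2m+2,m+1) binom(2m,m)\<close>. With \<open>B = binom(2m+1,m+1)\<close> and \<open>w = 2^(p-1) = 4^n\<close> it
  equals \<open>(1 + p) / ((1 - p) w) B^2\<close>. Modulo \<open>p^2\<close>, \<open>(1 + p)/(1 - p) \<equiv> 1 + 2p\<close>, and, because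
  \<open>p\<close> divides \<open>w - 1\<close>, \<open>1/w \<equiv> 2 - w\<close>; the product of the two is \<open>2p + 2 - w\<close>.
\<close>

section \<open>The localized integers\<close>

text \<open>Fractions in arbitrary terms are easier to add and multiply than fractions in lowest terms.\<close>

lemma Z_localized_iff:
  assumes "prime p"
  shows "x \<in> Z_localized p \<longleftrightarrow> (\<exists>a b. \<not> int p dvd b \<and> x = of_int a / of_int b)"
proof
  assume "x \<in> Z_localized p"
  moreover have "x = of_int (fst (quotient_of x)) / of_int (snd (quotient_of x))"
    by (intro quotient_of_div) simp
  ultimately show "\<exists>a b. \<not> int p dvd b \<and> x = of_int a / of_int b"
    using assms unfolding Z_localized_def
    by (metis (mono_tags, lifting) coprime_absorb_right mem_Collect_eq not_prime_unit prime_nat_int_transfer)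
next
  assume "\<exists>a b. \<not> int p dvd b \<and> x = of_int a / of_int b"
  then obtain a b where b: "\<not> int p dvd b" and x: "x = of_int a / of_int b" by blast
  obtain c e where ce: "quotient_of x = (c, e)" by fastforce
  have e: "e > 0" "coprime c e" "x = of_int c / of_int e"
    using ce by (auto intro: quotient_of_denom_pos quotient_of_coprime quotient_of_div)
  have "b \<noteq> 0" using b by auto
  then have "(of_int (a * e) :: rat) = of_int (c * b)"
    using e x by (simp add: field_simps)
  then have "a * e = c * b" by (simp only: of_int_eq_iff)
  then have "e dvd b"
    using e(2) by (metis coprime_commute coprime_dvd_mult_right_iff dvd_triv_right)
  then have "\<not> int p dvd e" using b dvd_trans by blast
  then have "coprime (int p) e"
    using assms by (intro prime_imp_coprime) auto
  then have "coprime e (int p)" by (simp add: coprime_commute)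
  then show "x \<in> Z_localized p" by (simp add: Z_localized_def ce)
qed

lemma of_int_Z_localized [simp]:
  assumes "prime p" shows "of_int a \<in> Z_localized p"
proof -
  have "\<not> int p dvd 1" using assms by auto
  then show ?thesis unfolding Z_localized_iff[OF assms]
    by (metis div_by_1 of_int_1)
qed

lemma of_nat_Z_localized [simp]:
  assumes "prime p" shows "of_nat a \<in> Z_localized p"
  using of_int_Z_localized[OF assms, of "int a"] by simp

lemma add_Z_localized:
  assumes "prime p" "x \<in> Z_localized p" "y \<in> Z_localized p"
  shows "x + y \<in> Z_localized p"
proof -
  obtain a b c e where h: "\<not> int p dvd b" "x = of_int a / of_int b"
    "\<not> int p dvd e" "y = of_int c / of_int e"
    using assms unfolding Z_localized_iff[OF assms(1)] by blast
  have "\<not> int p dvd b * e"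
    using h assms(1) by (simp add: prime_dvd_mult_iff)
  moreover have "x + y = of_int (a * e + c * b) / of_int (b * e)"
  proof -
    have "b \<noteq> 0" "e \<noteq> 0" using h by auto
    then show ?thesis using h by (simp add: add_frac_eq)
  qed
  ultimately show ?thesis unfolding Z_localized_iff[OF assms(1)] by blast
qed

lemma mult_Z_localized:
  assumes "prime p" "x \<in> Z_localized p" "y \<in> Z_localized p"
  shows "x * y \<in> Z_localized p"
proof -
  obtain a b c e where h: "\<not> int p dvd b" "x = of_int a / of_int b"
    "\<not> int p dvd e" "y = of_int c / of_int e"
    using assms unfolding Z_localized_iff[OF assms(1)] by blast
  have "\<not> int p dvd b * e"
    using h assms(1) by (simp add: prime_dvd_mult_iff)
  moreover have "x * y = of_int (a * c) / of_int (b * e)"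
    using h by auto
  ultimately show ?thesis unfolding Z_localized_iff[OF assms(1)] by blast
qed

lemma divide_Z_localized:
  assumes "prime p" "x \<in> Z_localized p" "\<not> int p dvd b"
  shows "x / of_int b \<in> Z_localized p"
proof -
  have "1 / of_int b \<in> Z_localized p"
    unfolding Z_localized_iff[OF assms(1)] using assms(3) by (metis of_int_1)
  from mult_Z_localized[OF assms(1,2) this] show ?thesis by simp
qed

lemma rat_congI:
  assumes "prime p" "y \<in> Z_localized p" "z \<in> Z_localized p" "x - y = of_nat (p ^ n) * z"
  shows "rat_cong p n x y"
proof -
  have "x = y + of_nat (p ^ n) * z" using assms(4) by (simp add: algebra_simps)
  then have "x \<in> Z_localized p"
    using assms by (metis add_Z_localized mult_Z_localized of_nat_Z_localized)
  then show ?thesis using assms unfolding rat_cong_def by blast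
qed

lemma rat_cong_refl:
  assumes "prime p" "x \<in> Z_localized p" shows "rat_cong p n x x"
  using of_nat_Z_localized[OF assms(1), of 0] assms by (intro rat_congI[of p x 0]) auto

lemma rat_cong_trans:
  assumes "prime p" "rat_cong p n x y" "rat_cong p n y z"
  shows "rat_cong p n x z"
proof -
  obtain u v where h: "u \<in> Z_localized p" "v \<in> Z_localized p" "z \<in> Z_localized p"
    "x - y = of_nat (p ^ n) * u" "y - z = of_nat (p ^ n) * v"
    using assms unfolding rat_cong_def by blast
  have "x - z = of_nat (p ^ n) * (u + v)" using h by (simp add: algebra_simps)
  then show ?thesis using h add_Z_localized assms(1) by (intro rat_congI) auto
qed

lemma rat_cong_mult_right:
  assumes "prime p" "rat_cong p n x y" "c \<in> Z_localized p"
  shows "rat_cong p n (x * c) (y * c)"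
proof -
  obtain u where h: "u \<in> Z_localized p" "y \<in> Z_localized p" "x - y = of_nat (p ^ n) * u"
    using assms unfolding rat_cong_def by blast
  have "x * c - y * c = of_nat (p ^ n) * (u * c)"
    using h(3) by (metis left_diff_distrib mult.assoc)
  then show ?thesis using h mult_Z_localized assms by (intro rat_congI) auto
qed

lemma rat_cong_add:
  assumes "prime p" "rat_cong p n x y" "rat_cong p n x' y'"
  shows "rat_cong p n (x + x') (y + y')"
proof -
  obtain u v where h: "u \<in> Z_localized p" "v \<in> Z_localized p"
    "y \<in> Z_localized p" "y' \<in> Z_localized p"
    "x - y = of_nat (p ^ n) * u" "x' - y' = of_nat (p ^ n) * v"
    using assms unfolding rat_cong_def by blast
  have "x + x' - (y + y') = of_nat (p ^ n) * (u + v)" using h by (simp add: algebra_simps)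
  then show ?thesis using h add_Z_localized assms(1) by (intro rat_congI) auto
qed

lemma rat_cong_sum:
  assumes "prime p" "finite A" "\<And>k. k \<in> A \<Longrightarrow> rat_cong p n (f k) (g k)"
  shows "rat_cong p n (sum f A) (sum g A)"
  using assms(2,3)
proof (induction A rule: finite_induct)
  case empty
  show ?case using rat_cong_refl[OF assms(1) of_nat_Z_localized[OF assms(1), of 0]] by simp
next
  case (insert a A)
  then show ?case using rat_cong_add[OF assms(1)] by simp
qed

section \<open>Shifted Legendre polynomials in homogeneous form\<close>

text \<open>The coefficient of \<open>x^k\<close> in the shifted Legendre polynomial \<open>P_n(1 - 2x)\<close>.\<close>

definition legendre_coeff :: "nat \<Rightarrow> nat \<Rightarrow> int" where
  "legendre_coeff n k = (-1) ^ k * int (n choose k) * int ((n + k) choose k)"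

lemma legendre_coeff_0 [simp]: "legendre_coeff n 0 = 1"
  by (simp add: legendre_coeff_def)

lemma legendre_coeff_eq_0: "k > n \<Longrightarrow> legendre_coeff n k = 0"
  by (simp add: legendre_coeff_def)

lemma choose_Suc_right: "(int k + 1) * int (n choose Suc k) = (int n - int k) * int (n choose k)"
proof (cases "k \<le> n")
  case True
  have "Suc k * (n choose Suc k) = (n - k) * (n choose k)"
    by (metis binomial_absorb_comp binomial_absorption diff_Suc_1 mult.commute)
  then have "int (Suc k * (n choose Suc k)) = int ((n - k) * (n choose k))" by (simp only:)
  then show ?thesis using True by (simp only: of_nat_mult of_nat_Suc of_nat_diff add.commute)
qed (simp add: not_le binomial_eq_0)

lemma choose_Suc_Suc: "(int k + 1) * int (Suc n choose Suc k) = (int n + 1) * int (n choose k)"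
proof -
  have "int (Suc k * (Suc n choose Suc k)) = int (Suc n * (n choose k))"
    by (simp only: Suc_times_binomial_eq mult.commute)
  then show ?thesis by (simp add: algebra_simps)
qed

lemma choose_Suc_left: "(int n + 1 - int k) * int (Suc n choose k) = (int n + 1) * int (n choose k)"
proof (cases "k \<le> Suc n")
  case True
  have "(Suc n - k) * (Suc n choose k) = Suc n * (n choose k)"
    using binomial_absorb_comp[of "Suc n" k] by simp
  then have "int ((Suc n - k) * (Suc n choose k)) = int (Suc n * (n choose k))" by (simp only:)
  then show ?thesis using True by (simp only: of_nat_mult of_nat_Suc of_nat_diff add.commute)
qed (simp add: not_le binomial_eq_0)

text \<open>The coefficients are hypergeometric in \<open>n\<close> and \<open>k\<close>. The next three lemmas give the ratios
  that express every term of the three-term recurrence through the single number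
  \<open>legendre_coeff (n + 1) k\<close>. They are stated without division, so that they remain true when some
  of the terms are zero.\<close>

lemma legendre_coeff_right:
  "(int k + 1)\<^sup>2 * legendre_coeff n (Suc k)
     = - (int n + int k + 1) * (int n - int k) * legendre_coeff n k"
proof -
  have "(int k + 1)\<^sup>2 * legendre_coeff n (Suc k)
      = - ((- 1) ^ k) * ((int k + 1) * int (n choose Suc k))
          * ((int k + 1) * int (Suc (n + k) choose Suc k))"
    unfolding legendre_coeff_def power2_eq_square power_Suc add_Suc_right
    by (simp only: mult_ac mult_minus_left mult_minus_right mult_1_left)
  also have "\<dots> = - (int n + int k + 1) * (int n - int k) * legendre_coeff n k"
    unfolding choose_Suc_right[of k n] choose_Suc_Suc legendre_coeff_def
    by (simp only: mult_ac mult_minus_left mult_minus_right of_nat_add)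
  finally show ?thesis .
qed

lemma legendre_coeff_Suc_right:
  "(int k + 1)\<^sup>2 * legendre_coeff (Suc n) (Suc k)
     = - (int n + int k + 1) * (int n + int k + 2) * legendre_coeff n k"
proof -
  have b: "(int n + 1) * int (Suc (n + k) choose k)
      = (int n + int k + 1) * int ((n + k) choose k)"
    using choose_Suc_left[of "n + k" k] by (simp only: of_nat_add of_nat_Suc) simp
  have "(int k + 1)\<^sup>2 * legendre_coeff (Suc n) (Suc k)
      = - ((- 1) ^ k) * ((int k + 1) * int (Suc n choose Suc k))
          * ((int k + 1) * int (Suc (Suc (n + k)) choose Suc k))"
    unfolding legendre_coeff_def power2_eq_square power_Suc add_Suc_right add_Suc
    by (simp only: mult_ac mult_minus_left mult_minus_right mult_1_left)
  also have "\<dots> = - ((- 1) ^ k) * int (n choose k) * (int (Suc (n + k)) + 1)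
          * ((int n + 1) * int (Suc (n + k) choose k))"
    unfolding choose_Suc_Suc
    by (simp only: mult_ac mult_minus_left mult_minus_right)
  also have "int (Suc (n + k)) + 1 = int n + int k + 2" by simp
  finally show ?thesis
    unfolding b legendre_coeff_def by (simp only: mult_ac mult_minus_left mult_minus_right)
qed

lemma legendre_coeff_left_right:
  "(int k + 1)\<^sup>2 * legendre_coeff n (Suc k)
     = - (int n - int k) * (int n + 1 - int k) * legendre_coeff (Suc n) k"
proof -
  have b: "(int n + 1) * int (Suc (n + k) choose k)
      = (int n + int k + 1) * int ((n + k) choose k)"
    using choose_Suc_left[of "n + k" k] by (simp only: of_nat_add of_nat_Suc) simp
  have "(int k + 1)\<^sup>2 * legendre_coeff n (Suc k)
      = - ((- 1) ^ k) * ((int k + 1) * int (n choose Suc k))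
          * ((int k + 1) * int (Suc (n + k) choose Suc k))"
    unfolding legendre_coeff_def power2_eq_square power_Suc add_Suc_right
    by (simp only: mult_ac mult_minus_left mult_minus_right mult_1_left)
  also have "\<dots> = - ((- 1) ^ k) * (int n - int k) * int (n choose k)
          * ((int n + int k + 1) * int ((n + k) choose k))"
    unfolding choose_Suc_Suc choose_Suc_right[of k n] by (simp only: of_nat_add mult_ac)
  also have "\<dots> = - ((- 1) ^ k) * (int n - int k) * ((int n + 1) * int (n choose k))
          * int (Suc (n + k) choose k)"
    unfolding b[symmetric] by (simp only: mult_ac)
  also have "\<dots> = - (int n - int k) * (int n + 1 - int k) * legendre_coeff (Suc n) k"
    unfolding choose_Suc_left[of n k, symmetric] legendre_coeff_def add_Suc
    by (simp only: mult_ac mult_minus_left mult_minus_right)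
  finally show ?thesis .
qed

text \<open>Bonnet's recurrence \<open>(n+2) P_(n+2)(y) = (2n+3) y P_(n+1)(y) - (n+1) P_n(y)\<close> at
  \<open>y = 1 - 2x\<close>, read off at \<open>x^(k+1)\<close>. After multiplication by \<open>(k+1)^2\<close> all terms are multiples of
  \<open>legendre_coeff (n + 1) k\<close>, and the factors satisfy a polynomial identity.\<close>

lemma legendre_coeff_recurrence:
  "int (n + 2) * legendre_coeff (n + 2) (Suc k)
     = int (2 * n + 3) * (legendre_coeff (n + 1) (Suc k) - 2 * legendre_coeff (n + 1) k)
       - int (n + 1) * legendre_coeff n (Suc k)"
proof -
  define s where "s = (int k + 1)\<^sup>2"
  have 1: "s * legendre_coeff (n + 2) (Suc k)
     = - (int n + int k + 2) * (int n + int k + 3) * legendre_coeff (n + 1) k"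
    using legendre_coeff_Suc_right[of k "n + 1"] by (simp add: s_def algebra_simps)
  have 2: "s * legendre_coeff (n + 1) (Suc k)
     = - (int n + int k + 2) * (int n + 1 - int k) * legendre_coeff (n + 1) k"
    using legendre_coeff_right[of k "n + 1"] by (simp add: s_def algebra_simps)
  have 3: "s * legendre_coeff n (Suc k)
     = - (int n - int k) * (int n + 1 - int k) * legendre_coeff (n + 1) k"
    using legendre_coeff_left_right[of k n] by (simp add: s_def)
  have "s * (int (n + 2) * legendre_coeff (n + 2) (Suc k))
      = int (n + 2) * (s * legendre_coeff (n + 2) (Suc k))" by simp
  also have "\<dots> = int (2 * n + 3) * (s * legendre_coeff (n + 1) (Suc k) - 2 * (s * legendre_coeff (n + 1) k))
       - int (n + 1) * (s * legendre_coeff n (Suc k))"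
    unfolding 1 2 3 unfolding s_def power2_eq_square by (simp add: algebra_simps)
  also have "\<dots> = s * (int (2 * n + 3) * (legendre_coeff (n + 1) (Suc k) - 2 * legendre_coeff (n + 1) k)
       - int (n + 1) * legendre_coeff n (Suc k))" by (simp add: algebra_simps)
  finally show ?thesis by (simp add: s_def)
qed

text \<open>\<open>w^n P_n(1 - 2u/w)\<close>. Homogenizing keeps the substitution \<open>u/w = (1 + z)^2 / (4z)\<close> inside the
  polynomials in \<open>z\<close>, so that Laurent polynomials are avoided.\<close>

definition legendre_hom :: "nat \<Rightarrow> 'a \<Rightarrow> 'a \<Rightarrow> 'a :: comm_ring_1" where
  "legendre_hom n u w = (\<Sum>k\<le>n. of_int (legendre_coeff n k) * u ^ k * w ^ (n - k))"

lemma legendre_hom_recurrence: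
  fixes u w :: "'a :: comm_ring_1"
  shows "of_nat (n + 2) * legendre_hom (n + 2) u w
    = of_nat (2 * n + 3) * (w - 2 * u) * legendre_hom (n + 1) u w
      - of_nat (n + 1) * w\<^sup>2 * legendre_hom n u w"
proof -
  let ?c = "\<lambda>n k. of_int (legendre_coeff n k) :: 'a"
  let ?m = "\<lambda>k. u ^ k * w ^ (n + 2 - k)"
  let ?f = "\<lambda>k. of_nat (2 * n + 3) * ?c (n + 1) k - of_nat (n + 1) * ?c n k"
  \<comment> \<open>Zero coefficients are added so that all sums run over the monomials of degree \<open>n + 2\<close>.\<close>
  have w1: "w * legendre_hom (n + 1) u w = (\<Sum>k\<le>n + 2. ?c (n + 1) k * ?m k)"
  proof -
    have "(\<Sum>k\<le>n + 2. ?c (n + 1) k * ?m k) = (\<Sum>k\<le>n + 1. ?c (n + 1) k * ?m k)"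
      by (simp add: legendre_coeff_eq_0)
    also have "\<dots> = w * legendre_hom (n + 1) u w"
      unfolding legendre_hom_def sum_distrib_left
      by (intro sum.cong) (auto simp: Suc_diff_le mult_ac)
    finally show ?thesis by simp
  qed
  have w2: "w\<^sup>2 * legendre_hom n u w = (\<Sum>k\<le>n + 2. ?c n k * ?m k)"
  proof -
    have "(\<Sum>k\<le>n + 2. ?c n k * ?m k) = (\<Sum>k\<le>n. ?c n k * ?m k)"
      by (simp add: legendre_coeff_eq_0)
    also have "\<dots> = w\<^sup>2 * legendre_hom n u w"
      unfolding legendre_hom_def sum_distrib_left
      by (intro sum.cong) (auto simp: Suc_diff_le power2_eq_square mult_ac)
    finally show ?thesis by simp
  qed
  have uu: "u * legendre_hom (n + 1) u w = (\<Sum>k\<le>n + 1. ?c (n + 1) k * ?m (Suc k))"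
    unfolding legendre_hom_def sum_distrib_left
    by (intro sum.cong) (auto simp: mult_ac)
  have rec: "of_nat (n + 2) * ?c (n + 2) (Suc k)
      = ?f (Suc k) - 2 * of_nat (2 * n + 3) * ?c (n + 1) k" for k
  proof -
    have "of_nat (n + 2) * ?c (n + 2) (Suc k) = of_int (int (n + 2) * legendre_coeff (n + 2) (Suc k))"
      by simp
    then show ?thesis unfolding legendre_coeff_recurrence by (simp add: algebra_simps)
  qed
  have split: "(\<Sum>k\<le>n + 2. h k) = h 0 + (\<Sum>k\<le>n + 1. h (Suc k))" for h :: "nat \<Rightarrow> 'a"
    using sum.atMost_Suc_shift[of h "n + 1"] by simp
  have "of_nat (n + 2) * legendre_hom (n + 2) u w
      = (\<Sum>k\<le>n + 2. of_nat (n + 2) * ?c (n + 2) k * ?m k)"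
    unfolding legendre_hom_def sum_distrib_left by (simp only: mult.assoc)
  also have "\<dots> = ?f 0 * ?m 0
      + (\<Sum>k\<le>n + 1. (?f (Suc k) - 2 * of_nat (2 * n + 3) * ?c (n + 1) k) * ?m (Suc k))"
    unfolding split rec by (simp add: algebra_simps)
  also have "\<dots> = (\<Sum>k\<le>n + 2. ?f k * ?m k)
      - 2 * of_nat (2 * n + 3) * (\<Sum>k\<le>n + 1. ?c (n + 1) k * ?m (Suc k))"
    unfolding split left_diff_distrib sum_subtractf sum_distrib_left
    by (simp add: mult.assoc algebra_simps)
  also have "(\<Sum>k\<le>n + 2. ?f k * ?m k)
      = of_nat (2 * n + 3) * (\<Sum>k\<le>n + 2. ?c (n + 1) k * ?m k)
        - of_nat (n + 1) * (\<Sum>k\<le>n + 2. ?c n k * ?m k)"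
    unfolding left_diff_distrib sum_subtractf sum_distrib_left by (simp only: mult.assoc)
  finally show ?thesis
    unfolding w1[symmetric] w2[symmetric] uu[symmetric]
    by (simp only: left_diff_distrib right_diff_distrib mult_ac) (simp add: algebra_simps)
qed

section \<open>The Fourier expansion of the Legendre polynomials\<close>

text \<open>\<open>z^n P_n(-(z + 1/z)/2)\<close> as a polynomial in \<open>z\<close>. The factor \<open>z^n\<close> shifts the coefficient of
  \<open>z^d\<close> to position \<open>n + d\<close>.\<close>

definition legendre_fourier :: "nat \<Rightarrow> rat poly" where
  "legendre_fourier n = legendre_hom n (smult (1/4) ([:1, 1:]\<^sup>2)) [:0, 1:]"

lemma coeff_legendre_fourier:
  "coeff (legendre_fourier n) (n + d)
     = (\<Sum>k\<le>n. of_int (legendre_coeff n k) * of_nat ((2 * k) choose (k + d)) / 4 ^ k)"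
proof -
  have "coeff (of_int (legendre_coeff n k) * (smult (1/4) ([:1, 1:]\<^sup>2)) ^ k * [:0, 1:] ^ (n - k)) (n + d)
     = of_int (legendre_coeff n k) * of_nat ((2 * k) choose (k + d)) / (4 :: rat) ^ k"
    if "k \<le> n" for k
  proof -
    have "[:0, 1 :: rat:] ^ (n - k) = monom 1 (n - k)"
      by (simp add: monom_altdef)
    moreover have "(smult (1/4) ([:1, 1 :: rat:]\<^sup>2)) ^ k = smult ((1/4) ^ k) ([:1, 1:] ^ (2 * k))"
      by (simp add: smult_power power_mult)
    moreover have "of_int (legendre_coeff n k) = [:of_int (legendre_coeff n k) :: rat:]"
      by (rule of_int_poly)
    moreover have "coeff ([:1, 1 :: rat:] ^ (2 * k)) i = of_nat ((2 * k) choose i)" for i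
    proof (cases "i \<le> 2 * k")
      case True
      then show ?thesis by (simp add: coeff_linear_poly_power)
    next
      case False
      have "degree ([:1, 1 :: rat:] ^ (2 * k)) \<le> degree [:1, 1 :: rat:] * (2 * k)"
        by (rule degree_power_le)
      then show ?thesis using False by (simp add: coeff_eq_0 binomial_eq_0)
    qed
    ultimately show ?thesis using that
      by (simp add: coeff_monom_mult mult.commute[of _ "monom _ _"] 
          power_divide add.commute) linarith
  qed
  then show ?thesis
    unfolding legendre_fourier_def legendre_hom_def coeff_sum by (intro sum.cong) auto
qed

text \<open>Here \<open>w - 2u = z - (1 + z)^2 / 2 = -(1 + z^2)/2\<close>: the terms of odd degree cancel, and this is
  where the parity condition of the first claim comes from.\<close>

lemma legendre_fourier_recurrence:
  "smult (of_nat (n + 2)) (legendre_fourier (n + 2))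
    = smult (- of_nat (2 * n + 3) / 2)
        (legendre_fourier (n + 1) + monom 1 2 * legendre_fourier (n + 1))
      - smult (of_nat (n + 1)) (monom 1 2 * legendre_fourier n)"
proof -
  have 1: "[:0, 1:] - 2 * smult (1/4) ([:1, 1:]\<^sup>2) = smult (-1/2) (1 + monom 1 2 :: rat poly)"
    by (simp add: power2_eq_square monom_altdef numeral_poly one_pCons)
  have 2: "[:0, 1 :: rat:]\<^sup>2 = monom 1 2" by (simp add: monom_altdef)
  have c: "of_nat k * q = smult (of_nat k) q" for k and q :: "rat poly"
    by (simp add: of_nat_poly)
  have s: "smult a q * r = smult a (q * r)" for a and q r :: "rat poly" by simp
  have "of_nat (n + 2) * legendre_fourier (n + 2)
    = of_nat (2 * n + 3) * smult (-1/2) (1 + monom 1 2) * legendre_fourier (n + 1)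
      - of_nat (n + 1) * monom 1 2 * legendre_fourier n"
    unfolding legendre_fourier_def legendre_hom_recurrence 1 2 ..
  then have "smult (of_nat (n + 2)) (legendre_fourier (n + 2))
    = smult (of_nat (2 * n + 3) * (-1/2)) ((1 + monom 1 2) * legendre_fourier (n + 1))
      - smult (of_nat (n + 1)) (monom 1 2 * legendre_fourier n)"
    unfolding mult.assoc c s smult_smult .
  also have "of_nat (2 * n + 3) * (-1/2) = (- of_nat (2 * n + 3) / 2 :: rat)" by (simp only: mult_minus_right times_divide_eq_right mult_1_right minus_divide_left)
  finally show ?thesis by (simp only: distrib_right mult_1_left)
qed

text \<open>The value is zero for \<open>j > n\<close> because \<open>legendre_fourier n\<close> has degree \<open>2 * n\<close>.\<close>

definition central_product :: "nat \<Rightarrow> nat \<Rightarrow> rat" where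
  "central_product n j =
     (if j \<le> n then of_nat ((2 * j) choose j) * of_nat ((2 * (n - j)) choose (n - j)) else 0)"

lemma central_binomial_Suc:
  "(of_nat n + 1) * (of_nat ((2 * Suc n) choose Suc n) :: rat)
     = 2 * (2 * of_nat n + 1) * of_nat ((2 * n) choose n)"
proof -
  have "(int n + 1) * int (Suc (Suc (2 * n)) choose Suc n) = (2 * int n + 2) * int (Suc (2 * n) choose n)"
    using choose_Suc_Suc[of n "Suc (2 * n)"] by (simp add: algebra_simps)
  moreover have "(int n + 1) * int (Suc (2 * n) choose n) = (2 * int n + 1) * int ((2 * n) choose n)"
    using choose_Suc_left[of "2 * n" n] by (simp add: algebra_simps)
  moreover have "2 * Suc n = Suc (Suc (2 * n))" by simp
  moreover have "(2 * int n + 2) * int (Suc (2 * n) choose n) = 2 * ((int n + 1) * int (Suc (2 * n) choose n))"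
    by (simp add: algebra_simps)
  ultimately have "(int n + 1) * int ((2 * Suc n) choose Suc n)
      = 2 * (2 * int n + 1) * int ((2 * n) choose n)"
    by (simp only: mult.assoc)
  then have "of_int ((int n + 1) * int ((2 * Suc n) choose Suc n))
      = (of_int (2 * (2 * int n + 1) * int ((2 * n) choose n)) :: rat)" by (simp only:)
  then show ?thesis by simp
qed

lemma central_product_0:
  "of_nat (n + 2) * central_product (n + 2) 0 = 2 * of_nat (2 * n + 3) * central_product (n + 1) 0"
  using central_binomial_Suc[of "n + 1"] by (simp add: central_product_def algebra_simps)

text \<open>Let \<open>x = j + 1\<close>, \<open>y = n + 1 - j\<close> and let \<open>r = 4 - 2/x\<close> and \<open>s = 4 - 2/y\<close> be the ratios of
  consecutive central binomial coefficients. If \<open>y > 0\<close>, the claim is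
  \<open>N r s = 2 (2N - 1) (r + s) - 16 (N - 1)\<close> with \<open>N = x + y = n + 2\<close>, an identity of rational
  functions. If \<open>y = 0\<close>, only the first and the third term survive.\<close>

lemma central_product_recurrence:
  "of_nat (n + 2) * central_product (n + 2) (Suc j)
     = 2 * of_nat (2 * n + 3) * (central_product (n + 1) (Suc j) + central_product (n + 1) j)
       - 16 * of_nat (n + 1) * central_product n j"
proof -
  let ?c = "\<lambda>j. of_nat ((2 * j) choose j) :: rat"
  have c: "?c (Suc m) = 2 * (2 * of_nat m + 1) / (of_nat m + 1) * ?c m" for m
    using central_binomial_Suc[of m] by (simp add: field_simps del: of_nat_Suc mult_Suc_right)
  consider "j > n + 1" | "j = n + 1" | "j \<le> n"
    by linarith
  then show ?thesis
  proof cases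
    case 1
    then show ?thesis by (simp add: central_product_def)
  next
    case 2
    then show ?thesis
      using central_binomial_Suc[of "n + 1"] by (simp add: central_product_def algebra_simps)
  next
    case 3
    then obtain b where b: "n = j + b" using le_Suc_ex by blast
    have d: "n + 2 - Suc j = Suc b" "n + 1 - Suc j = b" "n + 1 - j = Suc b" "n - j = b"
      using b by auto
    have le: "Suc j \<le> n + 2" "Suc j \<le> n + 1" "j \<le> n + 1" "j \<le> n" using 3 by auto
    have nz: "(of_nat j + 1 :: rat) \<noteq> 0" "(of_nat b + 1 :: rat) \<noteq> 0"
      by (metis of_nat_Suc of_nat_neq_0 add.commute)+
    have n: "of_nat (n + 2) = (of_nat j + of_nat b + 2 :: rat)"
      "of_nat (2 * n + 3) = (2 * of_nat j + 2 * of_nat b + 3 :: rat)"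
      "of_nat (n + 1) = (of_nat j + of_nat b + 1 :: rat)" by (simp_all add: b)
    show ?thesis
      unfolding central_product_def d n if_P[OF le(1)] if_P[OF le(2)] if_P[OF le(3)] if_P[OF le(4)]
        c[of j] c[of b]
      using nz by (simp add: divide_simps) (simp add: algebra_simps)
  qed
qed

text \<open>Both sides satisfy the same three-term recurrence in \<open>n\<close> and agree for \<open>n = 0\<close> and \<open>n = 1\<close>.\<close>

lemma coeff_legendre_fourier_closed:
  "coeff (legendre_fourier n) i = (if even i then (-1/4) ^ n * central_product n (i div 2) else 0)"
proof (induction n arbitrary: i rule: less_induct)
  case (less n)
  consider "n = 0" | "n = 1" | m where "n = m + 2"
    by (metis One_nat_def add_2_eq_Suc' not0_implies_Suc)
  then show ?case
  proof cases
    case 1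
    then show ?thesis
      by (auto simp: legendre_fourier_def legendre_hom_def central_product_def coeff_pCons
          elim!: evenE oddE split: nat.splits)
  next
    case 2
    have T: "legendre_coeff 1 1 = - 2" by (simp add: legendre_coeff_def)
    have q: "legendre_fourier 1 = smult (-1/2) (1 + monom 1 2)"
      unfolding legendre_fourier_def legendre_hom_def
      by (simp add: T[simplified] power2_eq_square monom_altdef numeral_poly one_pCons)
    consider "i = 0" | "i = 1" | "i = 2" | "i > 2" by linarith
    then show ?thesis unfolding 2 q
      by cases (simp_all add: central_product_def, presburger)
  next
    case (3 m)
    let ?q = "\<lambda>n. coeff (legendre_fourier n)"
    have IH: "?q (m + 1) i = (if even i then (-1/4) ^ (m + 1) * central_product (m + 1) (i div 2) else 0)"
      "?q m i = (if even i then (-1/4) ^ m * central_product m (i div 2) else 0)" for i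
      using less.IH[of "m + 1" i] less.IH[of m i] 3 by auto
    have "of_nat (m + 2) * ?q (m + 2) i
      = - of_nat (2 * m + 3) / 2 * (?q (m + 1) i + (if i < 2 then 0 else ?q (m + 1) (i - 2)))
        - of_nat (m + 1) * (if i < 2 then 0 else ?q m (i - 2))" (is "?l = ?r")
      using arg_cong[OF legendre_fourier_recurrence, of "\<lambda>q. coeff q i" m]
      by (simp add: coeff_monom_mult)
    also have "?r = of_nat (m + 2)
        * (if even i then (-1/4) ^ (m + 2) * central_product (m + 2) (i div 2) else 0)"
    proof (cases "even i")
      case False
      then show ?thesis by (simp add: IH del: One_nat_def add_Suc_right Suc_eq_plus1)
    next
      case True
      then obtain j where i: "i = 2 * j" by blast
      define e where "e = (-1/4 :: rat) ^ m"
      have e: "(-1/4 :: rat) ^ m = e" "(-1/4 :: rat) ^ (m + 1) = - e / 4"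
        "(-1/4 :: rat) ^ (m + 2) = e / 16"
        by (simp_all add: e_def)
      have l: "of_nat (m + 2) * (e / 16 * central_product (m + 2) j)
          = e / 16 * (of_nat (m + 2) * central_product (m + 2) j)" by simp
      show ?thesis
      proof (cases j)
        case 0
        have k: "even (2 * 0 :: nat)" "2 * 0 < (2 :: nat)" "2 * 0 div 2 = (0 :: nat)" by auto
        show ?thesis
          using l unfolding i 0 IH if_P[OF k(1)] if_P[OF k(2)] k(3) e central_product_0
          by (simp only:) (simp add: field_simps)
      next
        case (Suc k)
        have k: "even (2 * Suc k)" "even (2 * k)" "2 * Suc k - 2 = 2 * k" "\<not> 2 * Suc k < 2"
          "2 * Suc k div 2 = Suc k" "2 * k div 2 = k" by auto
        show ?thesis
          using l unfolding i Suc k(3) IH if_P[OF k(1)] if_P[OF k(2)] if_not_P[OF k(4)] k(5,6) e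
            central_product_recurrence
          by (simp only:) (simp add: field_simps)
      qed
    qed
    finally show ?thesis unfolding 3 by (simp del: of_nat_add)
  qed
qed

section \<open>Reduction modulo the square of a prime\<close>

text \<open>By induction on \<open>k\<close>. Passing from \<open>k\<close> to \<open>k + 1\<close> multiplies the left side by
  \<open>(2k+1)^2 / (2k+2)^2\<close> and the right side by
  \<open>-(n+k+1)(n-k) / (k+1)^2 = ((2k+1)^2 - p^2) / (2k+2)^2\<close>. The denominator is prime to \<open>p\<close>, since
  \<open>k < n\<close> gives \<open>2k + 2 < p\<close>.\<close>

lemma central_binomial_sq_cong_legendre_coeff:
  assumes "prime p" "p = 2 * n + 1" "k \<le> n"
  shows "rat_cong p 2 (of_nat ((2 * k) choose k) ^ 2 / 16 ^ k) (of_int (legendre_coeff n k))"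
  using assms(3)
proof (induction k)
  case 0
  show ?case using rat_cong_refl[OF assms(1) of_nat_Z_localized[OF assms(1), of 1]] by simp
next
  case (Suc k)
  let ?x = "\<lambda>k. of_nat ((2 * k) choose k) ^ 2 / 16 ^ k :: rat"
  let ?t = "\<lambda>k. of_int (legendre_coeff n k) :: rat"
  define b where "b = 2 * (int k + 1)"
  have b: "\<not> int p dvd b\<^sup>2"
  proof
    assume "int p dvd b\<^sup>2"
    then have "int p dvd b" using assms(1) by (simp add: prime_dvd_power_iff)
    then have "int p \<le> b" by (intro zdvd_imp_le) (auto simp: b_def)
    then show False using Suc.prems assms(2) by (simp add: b_def)
  qed
  then have b0: "(of_int (b\<^sup>2) :: rat) \<noteq> 0" by auto
  obtain z where z: "z \<in> Z_localized p" "?x k - ?t k = of_nat (p ^ 2) * z"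
    using Suc unfolding rat_cong_def by auto
  have "(of_int (b\<^sup>2)) * ?x (Suc k) = (2 * ((of_nat k + 1) * of_nat ((2 * Suc k) choose Suc k)))\<^sup>2 / 16 ^ Suc k"
    unfolding b_def of_int_power of_int_mult of_int_add of_int_of_nat_eq of_int_numeral of_int_1
    by (simp only: power_mult_distrib times_divide_eq_right mult.assoc)
  also have "\<dots> = (2 * of_nat k + 1)\<^sup>2 * ?x k"
    unfolding central_binomial_Suc power_mult_distrib power_Suc by simp
  finally have X: "(of_int (b\<^sup>2)) * ?x (Suc k) = (2 * of_nat k + 1)\<^sup>2 * ?x k" .
  have "b\<^sup>2 * legendre_coeff n (Suc k) = 4 * ((int k + 1)\<^sup>2 * legendre_coeff n (Suc k))"
    unfolding b_def power_mult_distrib by simp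
  also have "\<dots> = ((2 * int k + 1)\<^sup>2 - int p ^ 2) * legendre_coeff n k"
    unfolding legendre_coeff_right assms(2) by (simp add: algebra_simps power2_eq_square)
  finally have "(of_int (b\<^sup>2 * legendre_coeff n (Suc k)) :: rat)
      = of_int (((2 * int k + 1)\<^sup>2 - int p ^ 2) * legendre_coeff n k)" by (simp only:)
  then have T: "of_int (b\<^sup>2) * ?t (Suc k) = ((2 * of_nat k + 1)\<^sup>2 - of_nat (p\<^sup>2)) * ?t k"
    by simp
  have "of_int (b\<^sup>2) * (?x (Suc k) - ?t (Suc k))
      = (2 * of_nat k + 1)\<^sup>2 * (?x k - ?t k) + of_nat (p\<^sup>2) * ?t k"
    unfolding right_diff_distrib X T by (simp add: algebra_simps)
  also have "\<dots> = of_nat (p\<^sup>2) * (of_nat ((2 * k + 1)\<^sup>2) * z + ?t k)"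
    unfolding z by (simp add: algebra_simps)
  finally have "?x (Suc k) - ?t (Suc k)
      = of_nat (p\<^sup>2) * ((of_nat ((2 * k + 1)\<^sup>2) * z + ?t k) / of_int (b\<^sup>2))"
    using b0 by (simp add: field_simps)
  moreover have "(of_nat ((2 * k + 1)\<^sup>2) * z + ?t k) / of_int (b\<^sup>2) \<in> Z_localized p"
    using assms(1) z(1) b
    by (intro divide_Z_localized add_Z_localized mult_Z_localized
        of_nat_Z_localized of_int_Z_localized)
  ultimately show ?case using assms(1) by (intro rat_congI) auto
qed

lemma prime_dvd_central_binomial:
  assumes "prime p" "k < p" "p \<le> 2 * k"
  shows "p dvd ((2 * k) choose k)"
proof -
  have "fact k * fact (2 * k - k) * ((2 * k) choose k) = (fact (2 * k) :: nat)"
    by (intro binomial_fact_lemma) simp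
  moreover have "p dvd fact (2 * k)" "\<not> p dvd fact k"
    using assms by (auto simp: prime_dvd_fact_iff)
  ultimately show ?thesis using assms(1)
    by (metis add_diff_cancel_left' mult_2 prime_dvd_mult_iff)
qed

text \<open>The squared factor and \<open>16^k\<close> out of \<open>64^k\<close> reduce to \<open>legendre_coeff n k\<close>; the other factor
  and the remaining \<open>4^k\<close> form the coefficient of \<open>z^d\<close> in \<open>((1 + z)^2 / (4z))^k\<close>.\<close>

lemma rat_cong_coeff_legendre_fourier:
  assumes "prime p" "p = 2 * n + 1"
  shows "rat_cong p 2
    (\<Sum>k = 0..p - 1. of_nat ((2 * k) choose k) ^ 2 * of_nat ((2 * k) choose (k + d)) / 64 ^ k)
    (coeff (legendre_fourier n) (n + d))"
proof -
  have p4: "\<not> int p dvd 4 ^ k" for k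
  proof
    assume "int p dvd 4 ^ k"
    then have "int p dvd 2 ^ (2 * k)" by (simp add: power_mult)
    then have "int p dvd 2" using assms(1) prime_dvd_power by (metis prime_nat_int_transfer)
    then have "int p \<le> 2" by (intro zdvd_imp_le) auto
    then show False using assms prime_ge_2_nat[of p] by auto
  qed
  have x: "rat_cong p 2 (of_nat ((2 * k) choose k) ^ 2 / 16 ^ k) (of_int (legendre_coeff n k))"
    if "k \<le> p - 1" for k
  proof (cases "k \<le> n")
    case True
    then show ?thesis using central_binomial_sq_cong_legendre_coeff assms by blast
  next
    case False
    then have "p \<le> 2 * k" "k < p" using that assms(2) by auto
    then obtain c where c: "(2 * k) choose k = p * c"
      using prime_dvd_central_binomial[OF assms(1)] by (metis dvdE)
    have "(of_nat (c\<^sup>2) :: rat) / of_int (4 ^ (2 * k)) \<in> Z_localized p"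
      by (intro divide_Z_localized assms(1) p4 of_nat_Z_localized)
    then have "of_nat (c\<^sup>2) / 16 ^ k \<in> Z_localized p" by (simp add: power_mult)
    then show ?thesis
      using False assms(1) of_nat_Z_localized[OF assms(1), of 0] c
      by (intro rat_congI[of p _ "of_nat (c\<^sup>2) / 16 ^ k"])
        (auto simp: legendre_coeff_eq_0 power_mult_distrib)
  qed
  have "rat_cong p 2
    (\<Sum>k = 0..p - 1. of_nat ((2 * k) choose k) ^ 2 / 16 ^ k * (of_nat ((2 * k) choose (k + d)) / of_int (4 ^ k)))
    (\<Sum>k = 0..p - 1. of_int (legendre_coeff n k) * (of_nat ((2 * k) choose (k + d)) / of_int (4 ^ k)))"
    using assms(1) x p4
    by (intro rat_cong_sum rat_cong_mult_right divide_Z_localized) auto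
  moreover have "of_nat ((2 * k) choose k) ^ 2 / 16 ^ k * (of_nat ((2 * k) choose (k + d)) / of_int (4 ^ k))
      = (of_nat ((2 * k) choose k) ^ 2 * of_nat ((2 * k) choose (k + d)) / 64 ^ k :: rat)" for k
  proof -
    have "(64 :: rat) ^ k = 16 ^ k * 4 ^ k" by (simp flip: power_mult_distrib)
    then show ?thesis by simp
  qed
  moreover have "(\<Sum>k = 0..p - 1. of_int (legendre_coeff n k) * (of_nat ((2 * k) choose (k + d)) / of_int (4 ^ k)))
      = coeff (legendre_fourier n) (n + d)"
    unfolding coeff_legendre_fourier using assms(2)
    by (intro sum.mono_neutral_cong_right) (auto simp: legendre_coeff_eq_0)
  ultimately show ?thesis by (simp only:)
qed

text \<open>The coefficient is a rational multiple of \<open>B^2\<close>, because \<open>binom(2m+2,m+1) = 2 B\<close> and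
  \<open>binom(2m,m) = (m+1)/(2m+1) B\<close>, where \<open>4(m+1) = p + 1\<close> and \<open>2(2m+1) = p - 1\<close>.\<close>

lemma coeff_legendre_fourier_middle_cong:
  assumes "prime p" "p = 4 * m + 3"
  shows "rat_cong p 2 (coeff (legendre_fourier (2 * m + 1)) (2 * m + 2))
    ((2 * of_nat p + 2 - 2 ^ (p - 1)) * of_nat ((2 * m + 1) choose (m + 1)) ^ 2)"
proof -
  define B where "B = (of_nat ((2 * m + 1) choose (m + 1)) :: rat)"
  define w where "w = (2 :: int) ^ (p - 1)"
  have "\<not> int p dvd 2"
    using assms(2) zdvd_imp_le[of "int p" 2] by auto
  then have p2: "\<not> p dvd 2" by presburger
  have "[2 ^ (p - 1) = 1] (mod p)" using fermat_theorem[OF assms(1) p2] .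
  then have "[int (2 ^ (p - 1)) = int 1] (mod int p)" by (simp only: cong_int_iff)
  then have "int p dvd w - 1" by (simp add: w_def cong_iff_dvd_diff)
  then obtain t where t: "w = 1 + int p * t" by (metis dvdE diff_add_cancel add.commute)
  have w0: "\<not> int p dvd w"
    using assms(1) unfolding t by (metis dvd_add_times_triv_right_iff mult.commute not_prime_unit prime_nat_int_transfer)
  have pp: "\<not> int p dvd 1 - int p"
    using assms(1) by (metis dvd_refl dvd_diffD not_prime_unit prime_nat_int_transfer dvd_diff_right_iff dvd_diff_left_iff)
  have den: "\<not> int p dvd (1 - int p) * w"
    using w0 pp assms(1) by (simp add: prime_dvd_mult_iff)
  then have den0: "(of_int ((1 - int p) * w) :: rat) \<noteq> 0" by fastforce
  have c1: "of_nat ((2 * (m + 1)) choose (m + 1)) = 2 * B"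
  proof -
    have "(2 * m + 1) choose m = (2 * m + 1) choose (m + 1)"
      using binomial_symmetric[of m "2 * m + 1"] by simp
    then have "(2 * (m + 1)) choose (m + 1) = 2 * ((2 * m + 1) choose (m + 1))" by simp
    then show ?thesis unfolding B_def by (simp only: of_nat_mult of_nat_numeral)
  qed
  have c2: "(2 * of_nat m + 1) * of_nat ((2 * m) choose m) = (of_nat m + 1) * B"
  proof -
    have "(of_int ((2 * int m + 1) * int ((2 * m) choose m)) :: rat)
        = of_int ((int m + 1) * int (Suc (2 * m) choose Suc m))"
      unfolding choose_Suc_Suc by simp
    then show ?thesis unfolding B_def by (simp del: binomial_Suc_Suc)
  qed
  have "coeff (legendre_fourier (2 * m + 1)) (2 * m + 2)
      = (-1/4) ^ (2 * m + 1) * (of_nat ((2 * (m + 1)) choose (m + 1)) * of_nat ((2 * m) choose m))"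
    by (simp add: coeff_legendre_fourier_closed central_product_def)
  also have "(-1/4 :: rat) ^ (2 * m + 1) = - 1 / of_int w"
  proof -
    have "w = 4 ^ (2 * m + 1)"
    proof -
      have "p - 1 = 2 * (2 * m + 1)" using assms(2) by simp
      then show ?thesis unfolding w_def by (simp only: power_mult) simp
    qed
    then show ?thesis by (simp add: power_divide)
  qed
  finally have h: "coeff (legendre_fourier (2 * m + 1)) (2 * m + 2)
      = - 1 / of_int w * (of_nat ((2 * (m + 1)) choose (m + 1)) * of_nat ((2 * m) choose m))" .
  have V: "coeff (legendre_fourier (2 * m + 1)) (2 * m + 2)
      = (1 + of_nat p) / of_int ((1 - int p) * w) * B\<^sup>2"
  proof -
    have m0: "(2 * of_nat m + 1 :: rat) \<noteq> 0"
      by (metis of_nat_Suc of_nat_mult of_nat_neq_0 of_nat_numeral add.commute)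
    have C: "of_nat ((2 * m) choose m) = (of_nat m + 1) / (2 * of_nat m + 1) * B"
      using c2 m0 by (simp add: field_simps)
    have "(1 + of_nat p) / of_int ((1 - int p) * w)
        = (4 * (of_nat m + 1)) / (- 2 * (2 * of_nat m + 1) * of_int w :: rat)"
      unfolding assms(2) by (simp add: algebra_simps)
    also have "\<dots> = - 2 * (of_nat m + 1) / ((2 * of_nat m + 1) * of_int w)"
    proof -
      have "4 * x / (- 2 * y) = - 2 * x / y" for x y :: rat by simp
      then show ?thesis by (simp only: mult.assoc)
    qed
    finally have "(1 + of_nat p) / of_int ((1 - int p) * w) * B\<^sup>2
        = - 2 * (of_nat m + 1) / ((2 * of_nat m + 1) * of_int w) * B\<^sup>2" by (simp only:)
    also have "\<dots> = - 1 / of_int w * (2 * B * ((of_nat m + 1) / (2 * of_nat m + 1) * B))"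
      by (simp only: power2_eq_square times_divide_eq_left times_divide_eq_right divide_divide_eq_left
          mult_minus_left mult_minus_right mult_1_left mult_ac)
    finally show ?thesis unfolding h C c1 by (rule sym)
  qed
  \<comment> \<open>Put \<open>w = 1 + p t\<close>. Then \<open>1 + p - (2p + 2 - w) (1 - p) w = p^2 (2 - (2t - t^2) (1 - p))\<close>.\<close>
  define z where "z = of_int (2 - (2 * t - t\<^sup>2) * (1 - int p)) * of_nat (((2 * m + 1) choose (m + 1))\<^sup>2)
      / (of_int ((1 - int p) * w) :: rat)"
  have "z \<in> Z_localized p" unfolding z_def
    by (intro divide_Z_localized mult_Z_localized of_int_Z_localized of_nat_Z_localized assms(1) den)
  moreover have "coeff (legendre_fourier (2 * m + 1)) (2 * m + 2)
      - (2 * of_nat p + 2 - of_int w) * B\<^sup>2 = of_nat (p\<^sup>2) * z"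
  proof -
    define P T where "P = (of_nat p :: rat)" and "T = (of_int t :: rat)"
    define D where "D = (1 - P) * (1 + P * T)"
    have D: "of_int ((1 - int p) * w) = D" by (simp add: D_def P_def T_def t)
    then have D0: "D \<noteq> 0" using den0 by simp
    have "(1 + P) - (2 * P + 2 - (1 + P * T)) * D = P\<^sup>2 * (2 - (2 * T - T\<^sup>2) * (1 - P))"
      unfolding D_def power2_eq_square by (simp add: algebra_simps)
    then have "(1 + P) / D - (2 * P + 2 - (1 + P * T)) = P\<^sup>2 * (2 - (2 * T - T\<^sup>2) * (1 - P)) / D"
      using D0 by (simp add: field_simps)
    then have "(1 + P) / D * B\<^sup>2 - (2 * P + 2 - (1 + P * T)) * B\<^sup>2
        = P\<^sup>2 * (2 - (2 * T - T\<^sup>2) * (1 - P)) / D * B\<^sup>2"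
      by (metis left_diff_distrib)
    then show ?thesis
      unfolding V z_def D by (simp add: P_def T_def t B_def)
  qed
  moreover have "(2 * of_nat p + 2 - of_int w) * B\<^sup>2
      = of_int ((2 * int p + 2 - w) * int (((2 * m + 1) choose (m + 1))\<^sup>2))"
    by (simp add: B_def)
  moreover have "of_int w = (2 :: rat) ^ (p - 1)" by (simp add: w_def)
  ultimately show ?thesis
    using assms(1) of_int_Z_localized unfolding B_def by (metis rat_congI)
qed

theorem theorem1p1:
  fixes p :: nat
  assumes "prime p" and "odd p"
  shows "(\<forall>d \<in> {0..p - 1}. [d = (p + 1) div 2] (mod 2) \<longrightarrow>
            rat_cong p 2
              (\<Sum>k = 0..p - 1. of_nat ((2 * k) choose k) ^ 2 * of_nat ((2 * k) choose (k + d)) / 64 ^ k)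
              0)
       \<and> ([p = 3] (mod 4) \<longrightarrow>
            rat_cong p 2
              (\<Sum>k = 0..p - 1. of_nat ((2 * k) choose k) ^ 2 * of_nat ((2 * k) choose (k + 1)) / 64 ^ k)
              ((2 * of_nat p + 2 - 2 ^ (p - 1)) * of_nat (((p - 1) div 2) choose ((p + 1) div 4)) ^ 2))"
proof (intro conjI ballI impI)
  fix d assume d: "[d = (p + 1) div 2] (mod 2)"
  obtain n where n: "p = 2 * n + 1" using assms(2) by (rule oddE)
  have "odd (n + d)" using d unfolding n cong_def by simp presburger
  then have "coeff (legendre_fourier n) (n + d) = 0" by (simp add: coeff_legendre_fourier_closed)
  then show "rat_cong p 2
      (\<Sum>k = 0..p - 1. of_nat ((2 * k) choose k) ^ 2 * of_nat ((2 * k) choose (k + d)) / 64 ^ k) 0"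
    using rat_cong_coeff_legendre_fourier[OF assms(1) n, of d] by simp
next
  assume "[p = 3] (mod 4)"
  then have "p mod 4 = 3" by (simp add: cong_def)
  then obtain m where m: "p = 4 * m + 3" by (metis mult_div_mod_eq)
  have "(p - 1) div 2 = 2 * m + 1" "(p + 1) div 4 = m + 1" and n: "p = 2 * (2 * m + 1) + 1"
    using m by auto
  moreover have e: "2 * m + 1 + 1 = 2 * m + 2" by simp
  ultimately show "rat_cong p 2
      (\<Sum>k = 0..p - 1. of_nat ((2 * k) choose k) ^ 2 * of_nat ((2 * k) choose (k + 1)) / 64 ^ k)
      ((2 * of_nat p + 2 - 2 ^ (p - 1)) * of_nat (((p - 1) div 2) choose ((p + 1) div 4)) ^ 2)"
    using rat_cong_trans[OF assms(1) rat_cong_coeff_legendre_fourier[OF assms(1) n, of 1]]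
      coeff_legendre_fourier_middle_cong[OF assms(1) m] by (simp only: e)
qed

end
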